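(* Let $G$ be a simple connected graph on the vertex set $[n]$ with $\tau$ spanning trees, let $L$ be its Laplacian matrix, and let $L(n)\in\mathbb{Z}^{n\times(n-1)}$ be $L$ with its $n$-th column deleted. Let $\mathcal{P}_G$ be the Laplacian simplex of $G$, with vertices $\mathbf{v}_1,\dots,\mathbf{v}_n$ (the rows of $L(n)$, in order). Then \[ \Lambda(\mathcal{P}_G)=\left\{\frac{\mathbf{x}}{n\tau}\;\middle|\;\mathbf{x}\in\mathbb{Z}^n,\ 0\le x_i<n\tau \text{ for all } i,\ \mathbf{x}\cdot[L(n)\mid \mathbb{1}]\equiv \mathbf{0}\bmod n\tau\right\}. \]
   Context: The Laplacian matrix $L$ of a simple graph on $[n]$ has $L_{ii}=\deg(i)$, $L_{ij}=-1$ if $\{i,j\}$ is an edge and $0$ otherwise. The Laplacian simplex $\mathcal{P}_G$ is the convex hull in $\mathbb{R}^{n-1}$ of the rows of $L(n)$ (it is an $(n-1)$-simplex). $[L(n)\mid\mathbb{1}]\in\mathbb{Z}^{n\times n}$ is $L(n)$ with a column of all ones appended; vectors are row vectors. For a lattice simplex $\mathcal{P}$ with ordered vertices $\mathbf{v}_1,\dots,\mathbf{v}_{d+1}\in\mathbb{Z}^d$, $\Lambda(\mathcal{P})$ is the set of $\lambda=(\lambda_1,\dots,\lambda_{d+1})$ with $0\le\lambda_i<1$ such that $\sum_i\lambda_i(\mathbf{v}_i,1)\in\mathbb{Z}^{d+1}$ (these sums are the lattice points of the fundamental parallelepiped of $\mathcal{P}$). *)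

theory Defs
  imports
    "HOL-Number_Theory.Cong"
    "Jordan_Normal_Form.Matrix"
begin

text \<open>
  Matrices and vectors are indexed from 0, so the vertex set \<open>[n]\<close> is taken to be
  \<open>{0..<n}\<close>: the vertex \<open>i \<in> [n]\<close> of the usual numbering is \<open>i - 1\<close> here.
\<close>

definition simple_graph :: "'a set \<Rightarrow> 'a set set \<Rightarrow> bool" where
  "simple_graph V E \<longleftrightarrow> finite V \<and> E \<subseteq> {e. e \<subseteq> V \<and> card e = 2}"

definition adj :: "'a set set \<Rightarrow> 'a \<Rightarrow> 'a \<Rightarrow> bool" where
  "adj E u v \<longleftrightarrow> {u, v} \<in> E"

definition connected_graph :: "'a set \<Rightarrow> 'a set set \<Rightarrow> bool" where
  "connected_graph V E \<longleftrightarrow> V \<noteq> {} \<and> (\<forall>u\<in>V. \<forall>v\<in>V. (adj E)\<^sup>*\<^sup>* u v)"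

text \<open>A cycle is listed without repeating its first vertex at the end.\<close>

definition is_cycle :: "'a set set \<Rightarrow> 'a list \<Rightarrow> bool" where
  "is_cycle E c \<longleftrightarrow>
     3 \<le> length c \<and> distinct c \<and> successively (adj E) c \<and> adj E (last c) (hd c)"

definition is_tree :: "'a set \<Rightarrow> 'a set set \<Rightarrow> bool" where
  "is_tree V E \<longleftrightarrow> connected_graph V E \<and> (\<nexists>c. is_cycle E c)"

text \<open>A spanning subgraph has all the vertices, so it is given by its edge set.\<close>

definition spanning_trees :: "'a set \<Rightarrow> 'a set set \<Rightarrow> 'a set set set" where
  "spanning_trees V E = {T. T \<subseteq> E \<and> is_tree V T}"

definition vertex_degree :: "'a set set \<Rightarrow> 'a \<Rightarrow> nat" where
  "vertex_degree E v = card {e \<in> E. v \<in> e}"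

definition laplacian :: "nat \<Rightarrow> nat set set \<Rightarrow> int mat" where
  "laplacian n E = mat n n (\<lambda>(i, j).
     if i = j then int (vertex_degree E i) else if {i, j} \<in> E then -1 else 0)"

definition delete_last_col :: "'a mat \<Rightarrow> 'a mat" where
  "delete_last_col A = mat_of_cols (dim_row A) (butlast (cols A))"

definition append_ones_col :: "'a::one mat \<Rightarrow> 'a mat" where
  "append_ones_col A = mat_of_cols (dim_row A) (cols A @ [vec (dim_row A) (\<lambda>_. 1)])"

text \<open>
  A lattice simplex in \<open>\<real>\<^sup>d\<close> with ordered vertices is represented by the list of its
  \<open>d + 1\<close> vertices in \<open>\<int>\<^sup>d\<close>, of which it is the convex hull.
\<close>

definition laplacian_simplex :: "nat \<Rightarrow> nat set set \<Rightarrow> int vec list" where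
  "laplacian_simplex n E = rows (delete_last_col (laplacian n E))"

text \<open>The vector \<open>(v, 1)\<close>, with real entries.\<close>

definition homogenize :: "int vec \<Rightarrow> real vec" where
  "homogenize v = map_vec real_of_int (v @\<^sub>v vec 1 (\<lambda>_. 1))"

definition Lambda_set :: "nat \<Rightarrow> int vec list \<Rightarrow> real vec set" where
  "Lambda_set d vs = {l \<in> carrier_vec (d + 1).
     (\<forall>i<d + 1. 0 \<le> l $ i \<and> l $ i < 1) \<and>
     finsum_vec TYPE(real) (d + 1) (\<lambda>i. l $ i \<cdot>\<^sub>v homogenize (vs ! i)) {0..<d + 1}
       \<in> map_vec real_of_int ` carrier_vec (d + 1)}"

text \<open>\<open>x A\<close> for a row vector \<open>x\<close>.\<close>

definition row_vec_mult :: "'a::semiring_0 vec \<Rightarrow> 'a mat \<Rightarrow> 'a vec" where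
  "row_vec_mult x A = vec (dim_col A) (\<lambda>j. x \<bullet> col A j)"

end

theory Submission
  imports Defs
begin

text \<open>
  Suppose \<open>\<lambda> L\<close> is integral. Kirchhoff's averaging over spanning trees gives an explicit
  integral value for \<open>\<tau> (\<lambda>\<^sub>a - \<lambda>\<^sub>b)\<close>, with no determinants involved. For a spanning tree \<open>T\<close>,
  \<open>\<lambda>\<^sub>a - \<lambda>\<^sub>b\<close> is the sum of \<open>\<lambda>\<^sub>u - \<lambda>\<^sub>v\<close> over the edges \<open>uv\<close> of \<open>T\<close> whose removal leaves \<open>u\<close>
  with \<open>a\<close> and \<open>v\<close> with \<open>b\<close>. Sum over \<open>T\<close> and regroup by the two-component forest
  \<open>F = T - uv\<close>: for fixed \<open>F\<close> the edge \<open>uv\<close> runs over all edges of \<open>G\<close> leaving the component of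
  \<open>a\<close> in \<open>F\<close>, so the inner sum is the sum of the entries of \<open>\<lambda> L\<close> over that component.
  Since \<open>\<Sum>\<lambda>\<^sub>j\<close> is integral too, so is \<open>n \<tau> \<lambda>\<^sub>i = \<tau> \<Sum>\<^sub>j (\<lambda>\<^sub>i - \<lambda>\<^sub>j) + \<tau> \<Sum>\<^sub>j \<lambda>\<^sub>j\<close>.
\<close>

section \<open>Reachability in edge sets\<close>

abbreviation reach :: "'a set set \<Rightarrow> 'a \<Rightarrow> 'a \<Rightarrow> bool" where
  "reach F \<equiv> (adj F)\<^sup>*\<^sup>*"

lemma adj_commute: "adj F u v \<longleftrightarrow> adj F v u"
  by (simp add: adj_def insert_commute)

lemma reach_sym: "reach F u v \<Longrightarrow> reach F v u"
  using symp_rtranclp[of "adj F"] adj_commute by (metis sympD sympI)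

lemma reach_mono: "F \<subseteq> H \<Longrightarrow> reach F u v \<Longrightarrow> reach H u v"
  by (rule rtranclp_mono[THEN predicate2D]) (auto simp: adj_def)

lemma reach_edge: "{u, v} \<in> F \<Longrightarrow> reach F u v"
  by (simp add: adj_def r_into_rtranclp)

text \<open>A walk that crosses the new edge several times can be shortened to cross it at most
  once, in one of the two directions. With \<open>H = T - {{u, v}}\<close> this compares
  reachability before and after deleting an edge of \<open>T\<close>.\<close>

lemma reach_insertE:
  assumes "reach (insert {u, v} H) x y"
  shows "reach H x y \<or> reach H x u \<and> reach H v y \<or> reach H x v \<and> reach H u y"
  using assms
proof (induction rule: rtranclp_induct)
  case (step y z)
  show ?case
  proof (cases "adj H y z")
    case True
    then show ?thesis using step.IH by (meson rtranclp.rtrancl_into_rtrancl)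
  next
    case False
    then have "{y, z} = {u, v}" using step.hyps(2) by (auto simp: adj_def)
    then show ?thesis using step.IH by (auto simp: doubleton_eq_iff)
  qed
qed simp

section \<open>Acyclicity in terms of bridges\<close>

text \<open>Acyclicity stated through reachability, a form suited to inserting and deleting single
  edges. Loops are excluded as well, since \<open>reach\<close> is reflexive.\<close>

definition all_bridges :: "'a set set \<Rightarrow> bool" where
  "all_bridges F \<longleftrightarrow> (\<forall>u v. {u, v} \<in> F \<longrightarrow> \<not> reach (F - {{u, v}}) u v)"

lemma successively_reach:
  assumes "successively (adj F) c" "c \<noteq> []"
  shows "reach F (hd c) (last c)"
  using assms
proof (induction c rule: induct_list012)
  case (3 x y zs)
  then have "adj F x y" "reach F y (last (y # zs))" by auto
  then show ?case by (simp add: converse_rtranclp_into_rtranclp)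
qed auto

lemma reach_imp_path:
  assumes "reach F x y"
  obtains p where "p \<noteq> []" "hd p = x" "last p = y" "distinct p" "successively (adj F) p"
proof -
  from assms have "\<exists>p. p \<noteq> [] \<and> hd p = x \<and> last p = y \<and> distinct p \<and> successively (adj F) p"
  proof (induction rule: rtranclp_induct)
    case base
    show ?case by (intro exI[of _ "[x]"]) auto
  next
    case (step y z)
    then obtain p where p: "p \<noteq> []" "hd p = x" "last p = y" "distinct p" "successively (adj F) p"
      by blast
    show ?case
    proof (cases "z \<in> set p")
      case True
      \<comment> \<open>The walk returns to a vertex already listed, so the list is cut back to end
        there and stays distinct.\<close>
      then obtain q r where "p = q @ z # r" by (meson split_list)
      then show ?thesis using p
        by (intro exI[of _ "q @ [z]"]) (auto simp: successively_append_iff hd_append split: if_splits)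
    next
      case False
      then show ?thesis using p step.hyps
        by (intro exI[of _ "p @ [z]"]) (auto simp: successively_append_iff)
    qed
  qed
  then show thesis using that by blast
qed

text \<open>A simple path that joins the ends of an edge and avoids that edge closes up to a cycle;
  conversely, a cycle without its closing edge is such a path. The cardinality condition rules out
  loops, which are not bridges and yet form no cycle in the sense of
  \<open>is_cycle\<close>.\<close>

lemma no_cycle_iff_all_bridges:
  assumes "\<And>e. e \<in> F \<Longrightarrow> card e = 2"
  shows "(\<nexists>c. is_cycle F c) \<longleftrightarrow> all_bridges F"
proof
  assume no_cycle: "\<nexists>c. is_cycle F c"
  show "all_bridges F"
    unfolding all_bridges_def
  proof (intro allI impI notI)
    fix u v assume uv: "{u, v} \<in> F" and "reach (F - {{u, v}}) u v"
    then obtain p where p: "p \<noteq> []" "hd p = u" "last p = v" "distinct p"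
      "successively (adj (F - {{u, v}})) p"
      by (blast elim: reach_imp_path)
    have "u \<noteq> v" using assms[OF uv] by auto
    then obtain w q where "p = u # w # q" using p(1-3)
      by (metis last.simps list.sel(1) neq_Nil_conv)
    \<comment> \<open>A path with only two vertices would be the deleted edge itself.\<close>
    moreover from this have "q \<noteq> []" using p by (auto simp: adj_def)
    ultimately have "3 \<le> length p" by (cases q) auto
    moreover have "successively (adj F) p"
      using p(5) by (rule successively_mono) (auto simp: adj_def)
    ultimately have "is_cycle F p" using p uv by (simp add: is_cycle_def adj_def insert_commute)
    then show False using no_cycle by blast
  qed
next
  assume bridges: "all_bridges F"
  show "\<nexists>c. is_cycle F c"
  proof
    assume "\<exists>c. is_cycle F c"
    then obtain c where c: "3 \<le> length c" "distinct c" "successively (adj F) c" "adj F (last c) (hd c)"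
      by (auto simp: is_cycle_def)
    let ?e = "{hd c, last c}"
    have e: "?e \<in> F" using c(4) by (simp add: adj_def insert_commute)
    have ne: "c \<noteq> []" using c(1) by auto
    have "successively (adj (F - {?e})) c"
      unfolding successively_conv_nth
    proof (intro allI impI)
      fix i assume i: "Suc i < length c"
      have "adj F (c ! i) (c ! Suc i)" using c(3) i by (simp add: successively_conv_nth)
      \<comment> \<open>By distinctness the closing edge joins only the first and last positions,
        which are not consecutive in a list of length at least 3.\<close>
      moreover have "{c ! i, c ! Suc i} \<noteq> ?e"
        using i c(1,2) ne
        by (auto simp: hd_conv_nth last_conv_nth doubleton_eq_iff nth_eq_iff_index_eq)
      ultimately show "adj (F - {?e}) (c ! i) (c ! Suc i)" by (simp add: adj_def)
    qed
    then have "reach (F - {?e}) (hd c) (last c)" using ne by (rule successively_reach)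
    then show False using bridges e by (auto simp: all_bridges_def)
  qed
qed

lemma all_bridges_subset:
  assumes "all_bridges F" "H \<subseteq> F"
  shows "all_bridges H"
  using assms unfolding all_bridges_def
  by (meson Diff_mono reach_mono subset_iff order_refl)

text \<open>If an old edge \<open>{x, y}\<close> stopped being a bridge, the detour from
  \<open>x\<close> to \<open>y\<close> would pass through the new edge. As \<open>x\<close> and
  \<open>y\<close> are joined in \<open>F\<close>, so would be \<open>u\<close> and
  \<open>v\<close>.\<close>

lemma all_bridges_insert:
  assumes F: "all_bridges F" and uv: "\<not> reach F u v"
  shows "all_bridges (insert {u, v} F)"
  unfolding all_bridges_def
proof (intro allI impI notI)
  fix x y assume xy: "{x, y} \<in> insert {u, v} F"
    and r: "reach (insert {u, v} F - {{x, y}}) x y"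
  show False
  proof (cases "{x, y} = {u, v}")
    case True
    then have "insert {u, v} F - {{x, y}} \<subseteq> F" by auto
    then have "reach F x y" using r reach_mono by metis
    then show False using True uv reach_sym by (metis doubleton_eq_iff)
  next
    case False
    let ?H = "F - {{x, y}}"
    have "{x, y} \<in> F" using xy False by auto
    then have "reach F x y" "\<not> reach ?H x y"
      using F by (auto simp: all_bridges_def intro: reach_edge)
    moreover have "reach (insert {u, v} ?H) x y"
      using r by (rule reach_mono[rotated]) auto
    ultimately have "reach ?H x u \<and> reach ?H v y \<or> reach ?H x v \<and> reach ?H u y"
      using reach_insertE by metis
    then have "reach F x u \<and> reach F v y \<or> reach F x v \<and> reach F u y"
      using reach_mono[of ?H F] by blast
    then show False using uv \<open>reach F x y\<close> by (meson reach_sym rtranclp_trans)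
  qed
qed

section \<open>Spanning trees: existence and telescoping\<close>

lemma spanning_trees_iff:
  assumes "simple_graph V E"
  shows "T \<in> spanning_trees V E \<longleftrightarrow> T \<subseteq> E \<and> connected_graph V T \<and> all_bridges T"
proof (cases "T \<subseteq> E")
  case True
  then have "\<And>e. e \<in> T \<Longrightarrow> card e = 2" using assms by (auto simp: simple_graph_def)
  then show ?thesis
    using no_cycle_iff_all_bridges[of T] by (auto simp: spanning_trees_def is_tree_def)
qed (auto simp: spanning_trees_def)

lemma simple_graph_finite:
  assumes "simple_graph V E"
  shows "finite E"
  using assms by (auto simp: simple_graph_def intro: finite_subset[of _ "Pow V"])

lemma simple_graph_edgeD:
  assumes "simple_graph V E" "{u, v} \<in> E"
  shows "u \<in> V" "v \<in> V" "u \<noteq> v"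
  using assms by (auto simp: simple_graph_def)

lemma finite_spanning_trees:
  assumes "simple_graph V E"
  shows "finite (spanning_trees V E)"
  using simple_graph_finite[OF assms]
  by (auto simp: spanning_trees_def intro: finite_subset[of _ "Pow E"])

text \<open>A minimal connected set of edges is a spanning tree. Positivity is what permits the
  division by \<open>n * \<tau>\<close> later.\<close>

lemma card_spanning_trees_pos:
  assumes simple: "simple_graph V E" and conn: "connected_graph V E"
  shows "card (spanning_trees V E) > 0"
proof -
  let ?C = "{T. T \<subseteq> E \<and> connected_graph V T}"
  have "finite ?C" using simple_graph_finite[OF simple] by auto
  moreover have "E \<in> ?C" using conn by simp
  ultimately obtain T where T: "T \<in> ?C" and min: "\<And>H. H \<in> ?C \<Longrightarrow> H \<subseteq> T \<Longrightarrow> H = T"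
    using finite_has_minimal2[of ?C E] by metis
  have "all_bridges T"
    unfolding all_bridges_def
  proof (intro allI impI notI)
    fix u v assume uv: "{u, v} \<in> T" and r: "reach (T - {{u, v}}) u v"
    let ?H = "T - {{u, v}}"
    \<comment> \<open>The assumed detour from \<open>u\<close> to \<open>v\<close> replaces the
      deleted edge, so connectivity survives and minimality is contradicted.\<close>
    have "reach ?H x y" if "reach T x y" for x y
      using that uv r reach_insertE[of u v ?H x y]
      by (auto simp: insert_absorb dest: reach_sym intro: rtranclp_trans)
    then have "?H \<in> ?C" using T by (auto simp: connected_graph_def)
    then show False using min[of ?H] uv by blast
  qed
  then have "T \<in> spanning_trees V E" using T by (simp add: spanning_trees_iff[OF simple])
  then show ?thesis using finite_spanning_trees[OF simple] by (auto simp: card_gt_0_iff)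
qed

text \<open>
  Along an edge of the tree only the term of that edge changes, so no path from \<open>a\<close> to \<open>w\<close>
  has to be named.
\<close>

lemma tree_telescope:
  fixes f :: "'a \<Rightarrow> 'b::comm_ring_1"
  assumes fin: "finite V" and T: "T \<subseteq> {e. e \<subseteq> V}" "all_bridges T" and r: "reach T a w"
  shows "(\<Sum>(u, v) \<in> {(u, v). {u, v} \<in> T \<and> reach (T - {{u, v}}) a u \<and> reach (T - {{u, v}}) w v}. f u - f v)
    = f a - f w"
proof -
  let ?D = "{(u, v). {u, v} \<in> T}"
  \<comment> \<open>The condition sits in the summand, so that the index set \<open>?D\<close> does
    not depend on \<open>w\<close> and the sums for adjacent vertices can be subtracted term by
    term. \<open>?D\<close> holds each edge in both orientations.\<close>
  define h where "h w = (\<Sum>(u, v)\<in>?D. if reach (T - {{u, v}}) a u \<and> reach (T - {{u, v}}) w v then f u - f v else 0)" for w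
  have "?D \<subseteq> V \<times> V" using T by auto
  then have finD: "finite ?D" using fin by (meson finite_SigmaI finite_subset)
  from r have "h w = f a - f w"
  proof (induction rule: rtranclp_induct)
    case base
    have "\<not> (reach (T - {{u, v}}) a u \<and> reach (T - {{u, v}}) a v)" if "{u, v} \<in> T" for u v
      using T(2) that unfolding all_bridges_def by (meson reach_sym rtranclp_trans)
    then show ?case unfolding h_def by (auto intro!: sum.neutral)
  next
    case (step w x)
    then have wx: "{w, x} \<in> T" by (simp add: adj_def)
    let ?H = "T - {{w, x}}"
    have sep: "\<not> reach ?H w x" using T(2) wx by (simp add: all_bridges_def)
    then have "w \<noteq> x" by auto
    \<comment> \<open>Deleting the bridge \<open>{w, x}\<close> leaves \<open>a\<close> connected to
      exactly one of its ends.\<close>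
    have one: "reach ?H a w \<longleftrightarrow> \<not> reach ?H a x"
    proof
      show "reach ?H a w \<Longrightarrow> \<not> reach ?H a x" using sep by (meson reach_sym rtranclp_trans)
      show "\<not> reach ?H a x \<Longrightarrow> reach ?H a w"
        using step.hyps(1) wx reach_insertE[of w x ?H a w] by (auto simp: insert_absorb)
    qed
    let ?t = "\<lambda>w (u, v). if reach (T - {{u, v}}) a u \<and> reach (T - {{u, v}}) w v then f u - f v else 0"
    have "h x - h w = (\<Sum>p\<in>?D. ?t x p - ?t w p)"
      unfolding h_def by (simp add: sum_subtractf)
    also have "\<dots> = (\<Sum>p\<in>{(w, x), (x, w)}. ?t x p - ?t w p)"
    proof (rule sum.mono_neutral_right)
      show "{(w, x), (x, w)} \<subseteq> ?D" using wx by (auto simp: insert_commute)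
      show "\<forall>p\<in>?D - {(w, x), (x, w)}. ?t x p - ?t w p = 0"
      proof
        fix p assume p: "p \<in> ?D - {(w, x), (x, w)}"
        obtain u v where puv: "p = (u, v)" by (metis prod.exhaust)
        \<comment> \<open>Deleting any other edge keeps \<open>w\<close> and \<open>x\<close>
          joined, so its condition holds for both or for neither.\<close>
        have "{w, x} \<in> T - {{u, v}}" using wx p by (auto simp: puv doubleton_eq_iff)
        then have "reach (T - {{u, v}}) w x" by (rule reach_edge)
        then have "reach (T - {{u, v}}) x v \<longleftrightarrow> reach (T - {{u, v}}) w v"
          by (meson reach_sym rtranclp_trans)
        then show "?t x p - ?t w p = 0" by (simp add: puv)
      qed
    qed (rule finD)
    also have "\<dots> = (?t x (w, x) - ?t w (w, x)) + (?t x (x, w) - ?t w (x, w))"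
      using \<open>w \<noteq> x\<close> by simp
    \<comment> \<open>If \<open>a\<close> stays with \<open>w\<close>, the term of
      \<open>(w, x)\<close> appears; if \<open>a\<close> stays with \<open>x\<close>, the term of
      \<open>(x, w)\<close> disappears. The change is the same.\<close>
    also have "\<dots> = f w - f x"
      using sep one reach_sym[of ?H x w] by (auto simp: insert_commute[of x w])
    finally show ?case using step.IH by (simp add: algebra_simps)
  qed
  moreover have "h w = (\<Sum>(u, v) \<in> {(u, v). {u, v} \<in> T \<and> reach (T - {{u, v}}) a u \<and> reach (T - {{u, v}}) w v}. f u - f v)"
    unfolding h_def using finD
    by (intro sum.mono_neutral_cong_right) (auto split: if_splits)
  ultimately show ?thesis by simp
qed

section \<open>Cuts, two-component forests and Kirchhoff averaging\<close>

text \<open>A discrete divergence theorem: edges inside \<open>S\<close> occur in both orientations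
  with opposite signs and cancel, leaving the flow across the boundary.\<close>

lemma divergence_sum_eq_cut:
  fixes f :: "'a \<Rightarrow> 'b::comm_ring_1"
  assumes fin: "finite V" and S: "S \<subseteq> V"
  shows "(\<Sum>v\<in>S. \<Sum>w | w \<in> V \<and> {v, w} \<in> E. f v - f w)
    = (\<Sum>(v, w) \<in> {(v, w). v \<in> S \<and> w \<in> V - S \<and> {v, w} \<in> E}. f v - f w)"
proof -
  have finS: "finite S" using fin S finite_subset by blast
  let ?g = "\<lambda>v w. if {v, w} \<in> E then f v - f w else 0"
  have *: "(\<Sum>w | w \<in> V \<and> {v, w} \<in> E. f v - f w) = (\<Sum>w\<in>V. ?g v w)" for v
    using fin by (simp add: sum.inter_filter)
  have "(\<Sum>v\<in>S. \<Sum>w\<in>S. ?g v w) = (\<Sum>v\<in>S. \<Sum>w\<in>S. if {v, w} \<in> E then f v else 0)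
      - (\<Sum>v\<in>S. \<Sum>w\<in>S. if {v, w} \<in> E then f w else 0)"
    unfolding sum_subtractf[symmetric] by (intro sum.cong refl) simp
  also have "(\<Sum>v\<in>S. \<Sum>w\<in>S. if {v, w} \<in> E then f w else 0)
      = (\<Sum>v\<in>S. \<Sum>w\<in>S. if {v, w} \<in> E then f v else 0)"
    by (subst sum.swap) (simp add: insert_commute)
  finally have 0: "(\<Sum>v\<in>S. \<Sum>w\<in>S. ?g v w) = 0" by simp
  have "(\<Sum>v\<in>S. \<Sum>w\<in>V. ?g v w) = (\<Sum>v\<in>S. (\<Sum>w\<in>V - S. ?g v w) + (\<Sum>w\<in>S. ?g v w))"
    by (intro sum.cong refl sum.subset_diff[OF S fin])
  also have "\<dots> = (\<Sum>v\<in>S. \<Sum>w\<in>V - S. ?g v w)" using 0 by (simp add: sum.distrib)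
  also have "\<dots> = (\<Sum>(v, w)\<in>S \<times> (V - S). ?g v w)"
    by (simp add: sum.cartesian_product)
  also have "\<dots> = (\<Sum>(v, w) \<in> {(v, w). v \<in> S \<and> w \<in> V - S \<and> {v, w} \<in> E}. f v - f w)"
    using fin finS by (intro sum.mono_neutral_cong_right) (auto split: if_splits)
  finally show ?thesis by (simp add: *)
qed

text \<open>For \<open>a\<close> and \<open>b\<close> in \<open>V\<close>, these are the
  two-component forests of the averaging argument; the last condition makes them spanning.\<close>

definition separating_forests :: "'a set \<Rightarrow> 'a set set \<Rightarrow> 'a \<Rightarrow> 'a \<Rightarrow> 'a set set set" where
  "separating_forests V E a b = {F. F \<subseteq> E \<and> all_bridges F \<and> \<not> reach F a b \<and>
     (\<forall>v\<in>V. reach F a v \<or> reach F b v)}"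

text \<open>Double counting: moving an oriented edge out of the tree is a bijection from pairs of a
  spanning tree and an edge separating \<open>a\<close> from \<open>b\<close> in it to pairs of a
  separating forest and an edge of \<open>E\<close> across its two components. The identity holds
  for every \<open>f\<close>; integrality enters only afterwards.\<close>

lemma potential_difference_formula:
  fixes f :: "'a \<Rightarrow> 'b::comm_ring_1"
  assumes simple: "simple_graph V E" and V: "a \<in> V" "b \<in> V"
  shows "of_nat (card (spanning_trees V E)) * (f a - f b) =
    (\<Sum>F\<in>separating_forests V E a b. \<Sum>v | v \<in> V \<and> reach F a v. \<Sum>w | w \<in> V \<and> {v, w} \<in> E. f v - f w)"
proof -
  let ?ST = "spanning_trees V E" and ?SF = "separating_forests V E a b"
  let ?X = "\<lambda>T. {(u, v). {u, v} \<in> T \<and> reach (T - {{u, v}}) a u \<and> reach (T - {{u, v}}) b v}"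
  let ?Y = "\<lambda>F. {(u, v). {u, v} \<in> E \<and> reach F a u \<and> reach F b v}"
  let ?g = "\<lambda>(u, v). f u - f v"
  \<comment> \<open>The oriented edge is carried along, which makes the deletion invertible and
    keeps the summand unchanged.\<close>
  let ?j = "\<lambda>(T, (u, v)). (T - {{u, v}}, (u, v))"
  let ?i = "\<lambda>(F, (u, v)). (insert {u, v} F, (u, v))"
  have fin: "finite V" using simple by (simp add: simple_graph_def)
  have finE: "finite E" using simple by (rule simple_graph_finite)
  have fin_pairs: "finite {(u, v). {u, v} \<in> E \<and> P u v}" for P
    by (rule finite_subset[of _ "V \<times> V"])
      (use fin simple_graph_edgeD[OF simple] in auto)
  have finSF: "finite ?SF"
    using finE by (auto simp: separating_forests_def intro: finite_subset[of _ "Pow E"])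
  have finY: "finite (?Y F)" for F by (rule fin_pairs)
  have finX: "finite (?X T)" if "T \<in> ?ST" for T
    by (rule finite_subset[OF _ fin_pairs[of "\<lambda>_ _. True"]])
      (use that in \<open>auto simp: spanning_trees_def\<close>)
  have "of_nat (card ?ST) * (f a - f b) = (\<Sum>T\<in>?ST. f a - f b)" by simp
  also have "\<dots> = (\<Sum>T\<in>?ST. \<Sum>p\<in>?X T. ?g p)"
  proof (rule sum.cong[OF refl])
    fix T assume "T \<in> ?ST"
    then have T: "T \<subseteq> E" "connected_graph V T" "all_bridges T"
      using spanning_trees_iff[OF simple] by auto
    then have "T \<subseteq> {e. e \<subseteq> V}" "reach T a b"
      using simple V by (auto simp: simple_graph_def connected_graph_def)
    from tree_telescope[OF fin this(1) T(3) this(2), of f]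
    show "f a - f b = (\<Sum>p\<in>?X T. ?g p)" by simp
  qed
  also have "\<dots> = (\<Sum>(T, p)\<in>Sigma ?ST ?X. ?g p)"
    using finX by (intro sum.Sigma finite_spanning_trees[OF simple]) auto
  also have "\<dots> = (\<Sum>(F, p)\<in>Sigma ?SF ?Y. ?g p)"
  proof (rule sum.reindex_bij_witness[where i = ?i and j = ?j])
    fix p assume p: "p \<in> Sigma ?ST ?X"
    then show "?i (?j p) = p" by (auto simp: insert_absorb)
    obtain T u v where puv: "p = (T, (u, v))" by (metis prod.exhaust)
    let ?H = "T - {{u, v}}"
    have T: "T \<subseteq> E" "connected_graph V T" "all_bridges T" "{u, v} \<in> T" "reach ?H a u" "reach ?H b v"
      using p spanning_trees_iff[OF simple] by (auto simp: puv)
    have "\<not> reach ?H u v" using T by (simp add: all_bridges_def)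
    then have "\<not> reach ?H a b" using T by (meson reach_sym rtranclp_trans)
    moreover have "reach ?H a x \<or> reach ?H b x" if "x \<in> V" for x
    proof -
      have "reach T a x" using T that V by (auto simp: connected_graph_def)
      then show ?thesis using T reach_insertE[of u v ?H a x]
        by (auto simp: insert_absorb intro: rtranclp_trans)
    qed
    moreover have "all_bridges ?H" using T(3) by (rule all_bridges_subset) auto
    ultimately show "?j p \<in> Sigma ?SF ?Y"
      using T by (auto simp: puv separating_forests_def)
    show "(case ?j p of (F, p) \<Rightarrow> ?g p) = (case p of (T, p) \<Rightarrow> ?g p)" by (simp add: puv)
  next
    fix p assume p: "p \<in> Sigma ?SF ?Y"
    obtain F u v where puv: "p = (F, (u, v))" by (metis prod.exhaust)
    let ?T = "insert {u, v} F"
    have F: "F \<subseteq> E" "all_bridges F" "\<not> reach F a b" "\<forall>x\<in>V. reach F a x \<or> reach F b x"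
      "{u, v} \<in> E" "reach F a u" "reach F b v"
      using p by (auto simp: puv separating_forests_def)
    have uv: "\<not> reach F u v" using F by (meson reach_sym rtranclp_trans)
    then have "{u, v} \<notin> F" using reach_edge by metis
    then have H: "?T - {{u, v}} = F" by auto
    then show "?j (?i p) = p" by (simp add: puv)
    have mono: "reach ?T x y" if "reach F x y" for x y
      using that by (rule reach_mono[rotated]) auto
    have "reach ?T a b"
      using mono[OF F(6)] mono[OF reach_sym[OF F(7)]] reach_edge[of u v ?T]
      by (meson insertI1 rtranclp_trans)
    then have from_a: "reach ?T a x" if "x \<in> V" for x
      using F(4) that mono by (meson rtranclp_trans)
    then have "reach ?T x y" if "x \<in> V" "y \<in> V" for x y
      using that by (meson reach_sym rtranclp_trans)
    then have "connected_graph V ?T" using V by (auto simp: connected_graph_def)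
    moreover have "all_bridges ?T" using F(2) uv by (rule all_bridges_insert)
    ultimately have "?T \<in> ?ST" using F by (simp add: spanning_trees_iff[OF simple])
    then show "?i p \<in> Sigma ?ST ?X" using F H by (simp add: puv)
  qed
  also have "\<dots> = (\<Sum>F\<in>?SF. \<Sum>p\<in>?Y F. ?g p)"
    using finY finSF by (intro sum.Sigma[symmetric]) auto
  also have "\<dots> = (\<Sum>F\<in>?SF. \<Sum>v | v \<in> V \<and> reach F a v. \<Sum>w | w \<in> V \<and> {v, w} \<in> E. f v - f w)"
  proof (rule sum.cong[OF refl])
    fix F assume "F \<in> ?SF"
    then have F: "\<not> reach F a b" "\<forall>x\<in>V. reach F a x \<or> reach F b x"
      by (auto simp: separating_forests_def)
    let ?S = "{v. v \<in> V \<and> reach F a v}"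
    \<comment> \<open>The two components are complementary in \<open>V\<close>, so
      \<open>?Y F\<close> is the cut around the component of \<open>a\<close>.\<close>
    have "reach F b x \<longleftrightarrow> \<not> reach F a x" if "x \<in> V" for x
      using F that by (meson reach_sym rtranclp_trans)
    then have "?Y F = {(v, w). v \<in> ?S \<and> w \<in> V - ?S \<and> {v, w} \<in> E}"
      using simple_graph_edgeD[OF simple] by auto
    then show "(\<Sum>p\<in>?Y F. ?g p) = (\<Sum>v\<in>?S. \<Sum>w | w \<in> V \<and> {v, w} \<in> E. f v - f w)"
      using divergence_sum_eq_cut[OF fin, where S = ?S and E = E and f = f] by auto
  qed
  finally show ?thesis .
qed

lemma potential_difference_Ints:
  fixes f :: "'a \<Rightarrow> 'b::comm_ring_1"
  assumes simple: "simple_graph V E" and V: "a \<in> V" "b \<in> V"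
    and int: "\<And>v. v \<in> V \<Longrightarrow> (\<Sum>w | w \<in> V \<and> {v, w} \<in> E. f v - f w) \<in> \<int>"
  shows "of_nat (card (spanning_trees V E)) * (f a - f b) \<in> \<int>"
  unfolding potential_difference_formula[OF simple V] by (rule Ints_sum, rule Ints_sum, rule int) simp

section \<open>The Laplacian as a divergence operator\<close>

lemma vertex_degree_eq_card_neighbours:
  assumes simple: "simple_graph V E"
  shows "vertex_degree E v = card {w \<in> V. {v, w} \<in> E}"
proof -
  have "bij_betw (\<lambda>w. {v, w}) {w \<in> V. {v, w} \<in> E} {e \<in> E. v \<in> e}"
  proof (rule bij_betw_imageI)
    show "inj_on (\<lambda>w. {v, w}) {w \<in> V. {v, w} \<in> E}"
      by (auto simp: inj_on_def doubleton_eq_iff)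
    show "(\<lambda>w. {v, w}) ` {w \<in> V. {v, w} \<in> E} = {e \<in> E. v \<in> e}"
    proof (intro equalityI subsetI)
      fix e assume e: "e \<in> {e \<in> E. v \<in> e}"
      then have "e \<subseteq> V" "card e = 2" using simple by (auto simp: simple_graph_def)
      then obtain w where "e = {v, w}" using e
        by (auto simp: card_2_iff)
      then show "e \<in> (\<lambda>w. {v, w}) ` {w \<in> V. {v, w} \<in> E}" using e \<open>e \<subseteq> V\<close> by auto
    qed auto
  qed
  then show ?thesis by (simp add: vertex_degree_def bij_betw_same_card)
qed

text \<open>The degree on the diagonal contributes \<open>f j\<close> once per neighbour of
  \<open>j\<close>, and each off-diagonal -1 subtracts the value at that neighbour.\<close>

lemma laplacian_mult_eq_divergence:
  fixes f :: "nat \<Rightarrow> real"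
  assumes simple: "simple_graph {0..<n} E" and j: "j < n"
  shows "(\<Sum>i<n. f i * of_int (laplacian n E $$ (i, j)))
    = (\<Sum>w | w \<in> {0..<n} \<and> {j, w} \<in> E. f j - f w)"
proof -
  let ?N = "{w \<in> {0..<n}. {j, w} \<in> E}"
  have "j \<notin> ?N" using simple_graph_edgeD(3)[OF simple, of j j] by auto
  have "(\<Sum>i<n. f i * of_int (laplacian n E $$ (i, j)))
      = (\<Sum>i<n. (if i = j then f j * of_nat (card ?N) else 0) - (if {j, i} \<in> E then f i else 0))"
    using j \<open>j \<notin> ?N\<close> vertex_degree_eq_card_neighbours[OF simple, of j]
    by (intro sum.cong) (auto simp: laplacian_def insert_commute)
  also have "\<dots> = f j * of_nat (card ?N) - (\<Sum>i<n. if {j, i} \<in> E then f i else 0)"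
    using j by (simp add: sum_subtractf)
  also have "(\<Sum>i<n. if {j, i} \<in> E then f i else 0) = (\<Sum>w\<in>?N. f w)"
    by (intro sum.mono_neutral_cong_right) auto
  finally show ?thesis by (simp add: sum_subtractf mult.commute)
qed

text \<open>The cut around all of \<open>V\<close> is empty.\<close>

lemma sum_divergence:
  fixes f :: "'a \<Rightarrow> 'b::comm_ring_1"
  assumes "finite V"
  shows "(\<Sum>v\<in>V. \<Sum>w | w \<in> V \<and> {v, w} \<in> E. f v - f w) = 0"
  by (subst divergence_sum_eq_cut[OF assms order_refl]) simp

section \<open>Coordinates of the homogenized vertices and of \<open>Lambda_set\<close>\<close>

lemma append_ones_delete_last_index:
  assumes A: "A \<in> carrier_mat n n" and ij: "i < n" "j < n"
  shows "append_ones_col (delete_last_col A) $$ (i, j) = (if Suc j < n then A $$ (i, j) else 1)"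
proof -
  have "cols (delete_last_col A) = butlast (cols A)"
    unfolding delete_last_col_def
    using cols_dim[of A] by (intro cols_mat_of_cols subsetI) (meson in_set_butlastD subsetD)
  moreover have "dim_row (delete_last_col A) = n" using A by (simp add: delete_last_col_def)
  ultimately show ?thesis using A ij
    by (auto simp: append_ones_col_def mat_of_cols_index nth_append nth_butlast)
qed

lemma append_ones_delete_last_carrier:
  assumes "A \<in> carrier_mat n n" "0 < n"
  shows "append_ones_col (delete_last_col A) \<in> carrier_mat n n"
proof -
  have "dim_row A = n" "dim_col A = n" using assms(1) by (rule carrier_matD)+
  then show ?thesis using assms(2)
    by (intro carrier_matI) (simp_all add: append_ones_col_def delete_last_col_def)
qed

text \<open>Row \<open>i\<close> of the matrix with the column of ones is the homogenized vertex
  \<open>i\<close>; this links the simplex to the congruences.\<close>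

lemma homogenize_row_index:
  assumes A: "A \<in> carrier_mat n n" and ij: "i < n" "j < n"
  shows "homogenize (rows (delete_last_col A) ! i) $ j
    = of_int (append_ones_col (delete_last_col A) $$ (i, j))"
proof -
  have "dim_row (delete_last_col A) = n" "dim_col (delete_last_col A) = n - 1"
    using A by (auto simp: delete_last_col_def)
  moreover have "delete_last_col A $$ (i, j) = A $$ (i, j)" if "j < n - 1"
    using A ij that by (auto simp: delete_last_col_def mat_of_cols_index nth_butlast)
  ultimately show ?thesis using ij
    unfolding append_ones_delete_last_index[OF A ij]
    by (auto simp: homogenize_def)
qed

lemma homogenize_row_carrier:
  assumes "A \<in> carrier_mat n n" "i < n"
  shows "homogenize (rows (delete_last_col A) ! i) \<in> carrier_vec n"
proof -
  have "dim_row A = n" "dim_col A = n" using assms(1) by (rule carrier_matD)+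
  then show ?thesis using assms(2)
    by (intro carrier_vecI) (simp add: homogenize_def delete_last_col_def)
qed

lemma mem_map_of_int_carrier_vec_iff:
  "v \<in> map_vec real_of_int ` carrier_vec n \<longleftrightarrow> v \<in> carrier_vec n \<and> (\<forall>j<n. v $ j \<in> \<int>)"
proof
  assume v: "v \<in> carrier_vec n \<and> (\<forall>j<n. v $ j \<in> \<int>)"
  then have "v = map_vec real_of_int (vec n (\<lambda>j. \<lfloor>v $ j\<rfloor>))"
    by (intro eq_vecI) (auto elim: Ints_cases)
  then show "v \<in> map_vec real_of_int ` carrier_vec n" by (metis image_eqI vec_carrier)
qed auto

text \<open>For \<open>0 < n\<close> the dimension \<open>(n - 1) + 1\<close> is \<open>n\<close>,
  and membership in the lattice can be tested in each coordinate.\<close>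

lemma Lambda_set_rows_iff:
  assumes A: "A \<in> carrier_mat n n" and n: "0 < n"
  shows "l \<in> Lambda_set (n - 1) (rows (delete_last_col A)) \<longleftrightarrow>
    l \<in> carrier_vec n \<and> (\<forall>i<n. 0 \<le> l $ i \<and> l $ i < 1) \<and>
    (\<forall>j<n. (\<Sum>i<n. l $ i * of_int (append_ones_col (delete_last_col A) $$ (i, j))) \<in> \<int>)"
proof -
  let ?f = "\<lambda>i. l $ i \<cdot>\<^sub>v homogenize (rows (delete_last_col A) ! i)"
  have f: "?f \<in> {0..<n} \<rightarrow> carrier_vec n" using homogenize_row_carrier[OF A] by auto
  then have closed: "finsum_vec TYPE(real) n ?f {0..<n} \<in> carrier_vec n"
    by (intro finsum_vec_closed) auto
  have "finsum_vec TYPE(real) n ?f {0..<n} $ j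
      = (\<Sum>i<n. l $ i * of_int (append_ones_col (delete_last_col A) $$ (i, j)))" if j: "j < n" for j
    unfolding index_finsum_vec[OF finite_atLeastLessThan j f] lessThan_atLeast0
  proof (rule sum.cong[OF refl])
    fix i assume "i \<in> {0..<n}"
    then have i: "i < n" by simp
    have "?f i $ j = l $ i * homogenize (rows (delete_last_col A) ! i) $ j"
      using homogenize_row_carrier[OF A i] j by (intro index_smult_vec(1)) (simp only: carrier_vecD)
    then show "?f i $ j = l $ i * of_int (append_ones_col (delete_last_col A) $$ (i, j))"
      by (simp only: homogenize_row_index[OF A i j])
  qed
  then show ?thesis using n closed
    by (simp add: Lambda_set_def mem_map_of_int_carrier_vec_iff)
qed

text \<open>
  The columns of \<open>L\<close> sum to zero, so the deleted column imposes no further condition.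
\<close>

lemma integral_combination_denominator:
  fixes f :: "nat \<Rightarrow> real"
  assumes simple: "simple_graph {0..<n} E"
    and int: "\<And>j. j < n \<Longrightarrow>
      (\<Sum>i<n. f i * of_int (append_ones_col (delete_last_col (laplacian n E)) $$ (i, j))) \<in> \<int>"
    and k: "k < n"
  shows "real (n * card (spanning_trees {0..<n} E)) * f k \<in> \<int>"
proof -
  let ?t = "real (card (spanning_trees {0..<n} E))"
  let ?d = "\<lambda>v. \<Sum>w | w \<in> {0..<n} \<and> {v, w} \<in> E. f v - f w"
  have L: "laplacian n E \<in> carrier_mat n n" by (simp add: laplacian_def)
  have ini: "?d j \<in> \<int>" if "Suc j < n" for j
    using int[of j] that laplacian_mult_eq_divergence[OF simple, of j f]
    by (simp add: append_ones_delete_last_index[OF L])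
  \<comment> \<open>\<open>m\<close> is the last index: in the Laplacian it is the deleted column,
    in the extended matrix the column of ones.\<close>
  obtain m where m: "n = Suc m" using k by (cases n) auto
  have "(\<Sum>v\<in>{0..<n}. ?d v) = (\<Sum>v\<in>{0..<m}. ?d v) + ?d m"
    unfolding m by simp
  then have "?d m = - (\<Sum>v\<in>{0..<m}. ?d v)"
    using sum_divergence[of "{0..<n}" f E] by simp
  also have "\<dots> \<in> \<int>" using ini m by (intro Ints_minus Ints_sum[of _ ?d]) simp
  finally have "?d m \<in> \<int>" .
  then have all: "?d v \<in> \<int>" if "v \<in> {0..<n}" for v
    using ini[of v] that m by (cases "v = m") auto
  have "(\<Sum>i<n. f i * of_int (append_ones_col (delete_last_col (laplacian n E)) $$ (i, m)))
      = (\<Sum>i<n. f i)"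
  proof (rule sum.cong[OF refl])
    fix i assume "i \<in> {..<n}"
    then have "append_ones_col (delete_last_col (laplacian n E)) $$ (i, m) = 1"
      using append_ones_delete_last_index[OF L, of i m] m by simp
    then show "f i * of_int (append_ones_col (delete_last_col (laplacian n E)) $$ (i, m)) = f i"
      by simp
  qed
  then have sum: "(\<Sum>i<n. f i) \<in> \<int>" using int[of m] m by simp
  have "real (n * card (spanning_trees {0..<n} E)) * f k
      = (\<Sum>j<n. ?t * (f k - f j)) + ?t * (\<Sum>j<n. f j)"
    by (simp add: sum_distrib_left[symmetric] sum_subtractf) (simp add: algebra_simps)
  also have "\<dots> \<in> \<int>"
  proof (intro Ints_add Ints_mult[OF _ sum] Ints_of_nat Ints_sum)
    fix j assume "j \<in> {..<n}"
    then show "?t * (f k - f j) \<in> \<int>"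
      using k by (intro potential_difference_Ints[OF simple _ _ all]) auto
  qed
  finally show ?thesis .
qed

section \<open>Rescaling lattice points to integer vectors modulo \<open>n * \<tau>\<close>\<close>

theorem theorem3p6:
  fixes n \<tau> :: nat and E :: "nat set set" and Ln :: "int mat"
  assumes "simple_graph {0..<n} E"
    and "connected_graph {0..<n} E"
    and "\<tau> = card (spanning_trees {0..<n} E)"
    and "Ln = delete_last_col (laplacian n E)"
  shows "Lambda_set (n - 1) (laplacian_simplex n E) =
    {(1 / real (n * \<tau>)) \<cdot>\<^sub>v map_vec real_of_int x | x :: int vec.
       x \<in> carrier_vec n \<and>
       (\<forall>i<n. 0 \<le> x $ i \<and> x $ i < int (n * \<tau>)) \<and>
       (\<forall>j<n. [row_vec_mult x (append_ones_col Ln) $ j = 0] (mod int (n * \<tau>)))}"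
    (is "?Lam = ?R")
proof -
  let ?M = "append_ones_col Ln" and ?N = "n * \<tau>"
  have n: "0 < n" using assms(2) by (auto simp: connected_graph_def)
  have L: "laplacian n E \<in> carrier_mat n n" by (simp add: laplacian_def)
  have N: "0 < ?N" using n card_spanning_trees_pos[OF assms(1,2)] assms(3) by simp
  have M: "?M \<in> carrier_mat n n" using append_ones_delete_last_carrier[OF L n] assms(4) by simp
  have Lam: "l \<in> ?Lam \<longleftrightarrow> l \<in> carrier_vec n \<and> (\<forall>i<n. 0 \<le> l $ i \<and> l $ i < 1) \<and>
      (\<forall>j<n. (\<Sum>i<n. l $ i * of_int (?M $$ (i, j))) \<in> \<int>)" for l
    unfolding laplacian_simplex_def assms(4) by (rule Lambda_set_rows_iff[OF L n])
  \<comment> \<open>Dividing by the positive \<open>?N\<close> turns divisibility of a coordinate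
    into integrality, the condition appearing in \<open>Lam\<close>.\<close>
  have cong: "[row_vec_mult x ?M $ j = 0] (mod int ?N) \<longleftrightarrow>
      (\<Sum>i<n. x $ i / ?N * of_int (?M $$ (i, j))) \<in> \<int>" if x: "x \<in> carrier_vec n" and j: "j < n" for x j
  proof -
    have "row_vec_mult x ?M $ j = (\<Sum>i<n. x $ i * ?M $$ (i, j))"
      using M x j by (auto simp: row_vec_mult_def scalar_prod_def lessThan_atLeast0 intro!: sum.cong)
    then have "(\<Sum>i<n. x $ i / ?N * of_int (?M $$ (i, j))) = real_of_int (row_vec_mult x ?M $ j) / real_of_int (int ?N)"
      by (simp add: sum_divide_distrib)
    moreover have "real_of_int a / real_of_int (int ?N) \<in> \<int> \<longleftrightarrow> int ?N dvd a" for a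
    proof
      assume "real_of_int a / real_of_int (int ?N) \<in> \<int>"
      then obtain k where "real_of_int a / real_of_int (int ?N) = of_int k" by (elim Ints_cases)
      then have "real_of_int a = of_int (int ?N * k)" using N by (simp add: field_simps)
      then show "int ?N dvd a" by (metis dvd_triv_left of_int_eq_iff)
    qed (rule of_int_divide_in_Ints)
    ultimately show ?thesis by (simp add: cong_0_iff)
  qed
  show ?thesis
  proof (intro equalityI subsetI)
    fix l assume "l \<in> ?Lam"
    then have l: "l \<in> carrier_vec n" "\<And>i. i < n \<Longrightarrow> 0 \<le> l $ i" "\<And>i. i < n \<Longrightarrow> l $ i < 1"
      "\<And>j. j < n \<Longrightarrow> (\<Sum>i<n. l $ i * of_int (?M $$ (i, j))) \<in> \<int>"
      unfolding Lam by auto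
    \<comment> \<open>\<open>?N * l $ i\<close> is already integral by
      \<open>integral_combination_denominator\<close>; the floor only changes its type.\<close>
    define x where "x = vec n (\<lambda>i. \<lfloor>?N * l $ i\<rfloor>)"
    have x: "real_of_int (x $ i) = ?N * l $ i" if "i < n" for i
    proof -
      have "real ?N * l $ i \<in> \<int>"
        using integral_combination_denominator[OF assms(1) l(4)[unfolded assms(4)] that] assms(3) by simp
      then show ?thesis using that by (auto simp: x_def elim: Ints_cases)
    qed
    have xl: "x $ i / ?N = l $ i" if "i < n" for i
      using x[OF that] N by simp
    have "0 \<le> x $ i \<and> x $ i < int ?N" if "i < n" for i
    proof -
      have "0 \<le> real_of_int (x $ i)" "real_of_int (x $ i) < ?N"
        using N l(2,3)[OF that] unfolding x[OF that] by (simp_all add: mult_less_cancel_left1)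
      then show ?thesis by linarith
    qed
    moreover have xc: "x \<in> carrier_vec n" by (simp add: x_def)
    moreover have "[row_vec_mult x ?M $ j = 0] (mod int ?N)" if "j < n" for j
      unfolding cong[OF xc that] using l(4)[OF that] xl by simp
    moreover have "l = (1 / real ?N) \<cdot>\<^sub>v map_vec real_of_int x"
      using l(1) xl xc by (intro eq_vecI) auto
    ultimately show "l \<in> ?R" by blast
  next
    \<comment> \<open>The converse only rescales the bounds and the congruences; no spanning tree
      argument enters beyond \<open>0 < ?N\<close>.\<close>
    fix l assume "l \<in> ?R"
    then obtain x where x: "l = (1 / real ?N) \<cdot>\<^sub>v map_vec real_of_int x" "x \<in> carrier_vec n"
      "\<And>i. i < n \<Longrightarrow> 0 \<le> x $ i" "\<And>i. i < n \<Longrightarrow> x $ i < int ?N"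
      "\<And>j. j < n \<Longrightarrow> [row_vec_mult x ?M $ j = 0] (mod int ?N)"
      by blast
    have l: "l $ i = x $ i / ?N" if "i < n" for i using x(1,2) that by simp
    have "0 \<le> l $ i \<and> l $ i < 1" if "i < n" for i
    proof -
      have "real_of_int (x $ i) < real_of_int (int ?N)"
        using x(4)[OF that] by (simp only: of_int_less_iff)
      then show ?thesis using x(3)[OF that] N l[OF that] by (simp add: divide_less_eq)
    qed
    moreover have "(\<Sum>i<n. l $ i * of_int (?M $$ (i, j))) \<in> \<int>" if "j < n" for j
      using cong[OF x(2) that] x(5)[OF that] l by simp
    ultimately show "l \<in> ?Lam" unfolding Lam using x(1,2) by simp
  qed
qed

end
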